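(* Let $f(x) = \frac12 \langle A x, x\rangle - \langle b, x\rangle$ on $\mathbb{E}$, where $A : \mathbb{E} \to \mathbb{E}^*$ is self-adjoint positive definite and $b \in \mathbb{E}^*$. Let $B : \mathbb{E} \to \mathbb{E}^*$ be self-adjoint positive definite and let $\mu, L > 0$ satisfy $\mu B \preceq A \preceq L B$. Let $x_0 \in \mathbb{E}$ and $\phi_k \in [0,1]$ ($k \ge 0$) be arbitrary, and let the sequences $(x_k)$, $(G_k)$, $(u_k)$ be generated by $G_0 = L B$ and, for $k \ge 0$, $$x_{k+1} = x_k - G_k^{-1} \nabla f(x_k), \qquad u_k = x_{k+1} - x_k, \qquad G_{k+1} = \mathrm{Broyd}_{\phi_k}(A, G_k, u_k).$$ Then, for all $k \ge 0$, $$A \preceq G_k \preceq \frac{L}{\mu} A$$ and $$\lambda_f(x_k) \le \left(1 - \frac{\mu}{L}\right)^k \lambda_f(x_0).$$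
   Context: $\mathbb{E}$ is an $n$-dimensional real vector space with dual $\mathbb{E}^*$, and $\langle s, x\rangle$ is the value of $s \in \mathbb{E}^*$ at $x \in \mathbb{E}$. For self-adjoint linear operators $A, A_1 : \mathbb{E} \to \mathbb{E}^*$, $A \preceq A_1$ means $\langle (A_1 - A) x, x\rangle \ge 0$ for all $x \in \mathbb{E}$. For self-adjoint positive definite $A, G : \mathbb{E} \to \mathbb{E}^*$, $u \in \mathbb{E}\setminus\{0\}$ and $\phi \in \mathbb{R}$, define $$\mathrm{Broyd}_\phi(A,G,u) = \phi\left[ G - \frac{A u u^* G + G u u^* A}{\langle A u,u\rangle} + \left(\frac{\langle G u,u\rangle}{\langle A u,u\rangle} + 1\right)\frac{A u u^* A}{\langle A u,u\rangle}\right] + (1-\phi)\left[ G - \frac{G u u^* G}{\langle G u,u\rangle} + \frac{A u u^* A}{\langle A u,u\rangle}\right],$$ where $A u u^* G$ denotes the operator $h \mapsto \langle G u, h\rangle A u$, and similarly for the other products; and $\mathrm{Broyd}_\phi(A,G,0) = G$. For the quadratic function $f$ above, $\lambda_f(x) = \langle \nabla f(x), A^{-1} \nabla f(x)\rangle^{1/2}$, where $\nabla f(x) = A x - b \in \mathbb{E}^*$. *)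

theory Defs
  imports "HOL-Analysis.Analysis"
begin

text \<open>
  The space is modelled by a type of class \<open>euclidean_space\<close>, whose inner product is never used.
  Its dual is the type \<open>'a \<Rightarrow>\<^sub>L real\<close>, and the pairing of \<open>s\<close> with \<open>x\<close> is \<open>blinfun_apply s x\<close>.
  All linear maps from a finite-dimensional space are bounded, so bounded linear maps are no
  restriction.
\<close>

type_synonym 'a dual = "'a \<Rightarrow>\<^sub>L real"

type_synonym 'a dual_op = "'a \<Rightarrow>\<^sub>L 'a \<Rightarrow>\<^sub>L real"

definition self_adjoint :: "'a::euclidean_space dual_op \<Rightarrow> bool" where
  "self_adjoint A \<longleftrightarrow> (\<forall>x y. A x y = A y x)"

definition pos_def :: "'a::euclidean_space dual_op \<Rightarrow> bool" where
  "pos_def A \<longleftrightarrow> (\<forall>x. x \<noteq> 0 \<longrightarrow> A x x > 0)"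

definition loewner_le :: "'a::euclidean_space dual_op \<Rightarrow> 'a dual_op \<Rightarrow> bool"
    (infix \<open>\<preceq>\<^sub>L\<close> 50) where
  "A \<preceq>\<^sub>L A1 \<longleftrightarrow> (\<forall>x. (A1 - A) x x \<ge> 0)"

text \<open>
  \<open>inv_op A s\<close> is the value at \<open>s\<close> of the inverse operator from the dual to the space. It is
  meaningful only when \<open>A\<close> is bijective, as it is for positive definite \<open>A\<close>.
\<close>

definition inv_op :: "'a::euclidean_space dual_op \<Rightarrow> 'a dual \<Rightarrow> 'a" where
  "inv_op A = inv (blinfun_apply A)"

text \<open>
  \<open>outer s t\<close> maps \<open>h\<close> to \<open>t h *\<^sub>R s\<close>. For instance \<open>outer (A u) (G u)\<close> is the operator
  $A u u^* G$.
\<close>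

definition outer :: "'a::euclidean_space dual \<Rightarrow> 'a dual \<Rightarrow> 'a dual_op" where
  "outer s t = blinfun_scaleR_left s o\<^sub>L t"

lemma outer_apply [simp]: "outer s t h = t h *\<^sub>R s"
  by (simp add: outer_def)

definition Broyd ::
    "real \<Rightarrow> 'a::euclidean_space dual_op \<Rightarrow> 'a dual_op \<Rightarrow> 'a \<Rightarrow> 'a dual_op" where
  "Broyd \<phi> A G u =
    (if u = 0 then G
     else
       \<phi> *\<^sub>R (G - (1 / A u u) *\<^sub>R (outer (A u) (G u) + outer (G u) (A u))
              + ((G u u / A u u + 1) / A u u) *\<^sub>R outer (A u) (A u))
       + (1 - \<phi>) *\<^sub>R (G - (1 / G u u) *\<^sub>R outer (G u) (G u)
              + (1 / A u u) *\<^sub>R outer (A u) (A u)))"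

text \<open>The gradient is the Frechet derivative, as an element of the dual.\<close>

definition gradient :: "('a::euclidean_space \<Rightarrow> real) \<Rightarrow> 'a \<Rightarrow> 'a dual" where
  "gradient f x = Blinfun (frechet_derivative f (at x))"

definition quadratic_fun :: "'a::euclidean_space dual_op \<Rightarrow> 'a dual \<Rightarrow> 'a \<Rightarrow> real" where
  "quadratic_fun A b x = 1 / 2 * A x x - b x"

lemma gradient_quadratic_fun:
  assumes "self_adjoint A"
  shows "gradient (quadratic_fun A b) x = A x - b"
proof -
  have "((\<lambda>x. 1 / 2 * A x x - b x) has_derivative blinfun_apply (A x - b)) (at x)"
    by (rule derivative_eq_intros refl | rule ext)+
      (use assms in \<open>simp add: self_adjoint_def blinfun.diff_left\<close>)
  hence "(quadratic_fun A b has_derivative blinfun_apply (A x - b)) (at x)"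
    by (simp add: quadratic_fun_def[abs_def])
  hence "frechet_derivative (quadratic_fun A b) (at x) = blinfun_apply (A x - b)"
    by (metis frechet_derivative_at)
  thus ?thesis
    by (simp add: gradient_def blinfun_apply_inverse)
qed

text \<open>The operator \<open>A\<close> is the Hessian of \<open>f\<close>, which is constant for quadratic \<open>f\<close>.\<close>

definition local_grad_norm ::
    "('a::euclidean_space \<Rightarrow> real) \<Rightarrow> 'a dual_op \<Rightarrow> 'a \<Rightarrow> real" where
  "local_grad_norm f A x = sqrt (gradient f x (inv_op A (gradient f x)))"

end

theory Submission
  imports Defs
begin

text \<open>
  Everything reduces to quadratic forms. For $u \<noteq> 0$ let $P_A h$ and $P_G h$ be the components of
  $h$ that are orthogonal to $u$ with respect to $A$ and to $G$. Completing squares turns the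
  Broyden update $G_+$ of $G$ into
  \[ \langle G_+ h, h\rangle = \phi \langle G P_A h, P_A h\rangle
     + (1-\phi) \langle G P_G h, P_G h\rangle + \langle A u, h\rangle^2 / \langle A u, u\rangle, \]
  and Pythagoras gives
  $\langle A h, h\rangle = \langle A P_A h, P_A h\rangle + \langle A u, h\rangle^2/\langle A u, u\rangle$.
  So only the projected terms have to be compared. Both $P_A h$ and $P_G h$ lie on the line
  $h + \mathbb{R} u$, on which $P_A h$ minimises the form of $A$ and $P_G h$ the form of $G$.
  If $A \preceq G \preceq \eta A$ with $\eta \<ge> 1$, both projected terms therefore lie between
  $\langle A P_A h, P_A h\rangle$ and $\eta \langle A P_A h, P_A h\rangle$, which yields
  \<open>Broyd_sandwich\<close>: the update preserves $A \preceq G \preceq \eta A$.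

  For the rate, put $v = A^{-1} \nabla f(x_k)$. The gradient of a quadratic is affine, so a step with
  $G$ replaces $v$ by $v - G^{-1} A v$, and $\lambda_f$ is the $A$-norm of $v$. The operator
  $I - G^{-1} A$ is self-adjoint for the form of $A$, and the sandwich puts its spectrum into
  $[0, 1 - 1/\eta]$; hence it contracts the $A$-norm by the factor $1 - 1/\eta$
  (\<open>quasi_Newton_contraction\<close>). Here $\eta = L/\mu$.
\<close>

section \<open>Quadratic forms and their Loewner order\<close>

lemma loewner_le_iff: "A \<preceq>\<^sub>L C \<longleftrightarrow> (\<forall>h. A h h \<le> C h h)"
  by (simp add: loewner_le_def blinfun.diff_left)

lemma self_adjointD: "self_adjoint A \<Longrightarrow> A h k = A k h"
  by (simp add: self_adjoint_def)

lemma pos_def_nonneg: "pos_def A \<Longrightarrow> A h h \<ge> 0"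
  by (cases "h = 0") (auto simp: pos_def_def intro: less_imp_le)

lemma pos_def_mono: "pos_def A \<Longrightarrow> A \<preceq>\<^sub>L C \<Longrightarrow> pos_def C"
  unfolding pos_def_def loewner_le_iff by (meson less_le_trans)

lemma self_adjoint_diff_expand:
  assumes "self_adjoint A"
  shows "A (h - t *\<^sub>R u) (h - t *\<^sub>R u) = A h h - 2 * t * A u h + t\<^sup>2 * A u u"
  by (simp add: blinfun.diff_left blinfun.diff_right blinfun.scaleR_left blinfun.scaleR_right
      self_adjointD[OF assms, of h u] power2_eq_square algebra_simps)

text \<open>
  A functional is determined by its values on the basis. Taking these values as coordinates sends
  the dual into the space, so the injective map \<open>A\<close> becomes an injective endomorphism, which is
  surjective by dimension.
\<close>

lemma pos_def_bij:
  fixes A :: "'a::euclidean_space dual_op"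
  assumes "pos_def A"
  shows "bij (blinfun_apply A)"
proof -
  define R :: "'a dual \<Rightarrow> 'a" where "R s = (\<Sum>i\<in>Basis. s i *\<^sub>R i)" for s
  have R_inj: "s = t" if "R s = R t" for s t
  proof (rule blinfun_euclidean_eqI)
    fix i :: 'a assume i: "i \<in> Basis"
    have "R r \<bullet> i = r i" for r
      unfolding R_def using i by (rule inner_sum_left_Basis)
    from this[of s] this[of t] that show "s i = t i" by simp
  qed
  have A_inj: "h = k" if "A h = A k" for h k
  proof (rule ccontr)
    assume "h \<noteq> k"
    hence "A (h - k) (h - k) > 0" using assms by (simp add: pos_def_def)
    moreover have "A (h - k) = 0" using that by (simp add: blinfun.diff_right)
    ultimately show False by simp
  qed
  have "linear (\<lambda>h. R (A h))"
    unfolding R_def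
    by (intro linear_compose_sum ballI linearI)
      (simp_all add: blinfun.add_left blinfun.add_right blinfun.scaleR_left blinfun.scaleR_right
        scaleR_add_left)
  moreover have "inj (\<lambda>h. R (A h))"
    by (intro injI) (rule A_inj[OF R_inj])
  ultimately have surj_RA: "surj (\<lambda>h. R (A h))"
    by (intro linear_injective_imp_surjective refl)
  show ?thesis
  proof (intro bijI injI A_inj)
    have "\<exists>h. s = A h" for s
    proof -
      obtain h where "R s = R (A h)" using surj_RA by (rule surjE)
      from R_inj[OF this] show ?thesis by (rule exI)
    qed
    thus "surj (blinfun_apply A)" by (simp add: surj_def)
  qed
qed

lemma inv_op_right: "pos_def A \<Longrightarrow> A (inv_op A s) = s"
  unfolding inv_op_def by (rule surj_f_inv_f[OF bij_is_surj[OF pos_def_bij]])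

lemma inv_op_left: "pos_def A \<Longrightarrow> inv_op A (A h) = h"
  unfolding inv_op_def by (rule inv_f_f[OF bij_is_inj[OF pos_def_bij]])

section \<open>The Broyden update in projected form\<close>

definition conj_proj :: "'a::euclidean_space dual_op \<Rightarrow> 'a \<Rightarrow> 'a \<Rightarrow> 'a" where
  "conj_proj A u h = h - (A u h / A u u) *\<^sub>R u"

lemma conj_proj_Pythagoras:
  assumes "self_adjoint A" "A u u \<noteq> 0"
  shows "A h h = A (conj_proj A u h) (conj_proj A u h) + (A u h)\<^sup>2 / A u u"
  unfolding conj_proj_def self_adjoint_diff_expand[OF assms(1)]
  using assms(2) by (simp add: field_simps power2_eq_square)

text \<open>
  Along the line through \<open>h\<close> in direction \<open>u\<close> the form of \<open>A\<close> is a parabola, with vertex at the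
  projection and leading coefficient \<open>A u u\<close>.
\<close>

lemma conj_proj_minimal:
  assumes "self_adjoint A" "A u u > 0"
  shows "A (conj_proj A u h) (conj_proj A u h) \<le> A (h - t *\<^sub>R u) (h - t *\<^sub>R u)"
proof -
  have "A (h - t *\<^sub>R u) (h - t *\<^sub>R u)
      = A (conj_proj A u h) (conj_proj A u h) + A u u * (t - A u h / A u u)\<^sup>2"
    unfolding conj_proj_def self_adjoint_diff_expand[OF assms(1)]
    using assms(2) by (simp add: field_simps power2_eq_square)
  thus ?thesis using assms(2) by simp
qed

lemma Broyd_self_adjoint:
  "self_adjoint A \<Longrightarrow> self_adjoint G \<Longrightarrow> self_adjoint (Broyd \<phi> A G u)"
  by (simp add: self_adjoint_def Broyd_def blinfun.add_left blinfun.diff_left blinfun.scaleR_left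
      algebra_simps)

text \<open>
  The bracket weighted by \<open>\<phi>\<close> (the DFP update) is \<open>G\<close> compressed along the \<open>A\<close>-projection, the
  other one (the BFGS update) is \<open>G\<close> compressed along the \<open>G\<close>-projection; both add the same
  rank-one term.
\<close>

lemma Broyd_quadratic_form:
  assumes "self_adjoint A" "self_adjoint G" "A u u > 0" "G u u > 0"
  shows "Broyd \<phi> A G u h h =
    \<phi> * G (conj_proj A u h) (conj_proj A u h) + (1 - \<phi>) * G (conj_proj G u h) (conj_proj G u h)
      + (A u h)\<^sup>2 / A u u"
proof -
  have "u \<noteq> 0" using assms(3) by auto
  hence "Broyd \<phi> A G u h h =
     \<phi> * (G h h - (1 / A u u) * (2 * A u h * G u h) + ((G u u / A u u + 1) / A u u) * (A u h)\<^sup>2)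
     + (1 - \<phi>) * (G h h - (1 / G u u) * (G u h)\<^sup>2 + (1 / A u u) * (A u h)\<^sup>2)"
    by (simp add: Broyd_def blinfun.add_left blinfun.diff_left blinfun.scaleR_left
        power2_eq_square mult_ac)
  also have "G h h - (1 / A u u) * (2 * A u h * G u h) + ((G u u / A u u + 1) / A u u) * (A u h)\<^sup>2
     = G (conj_proj A u h) (conj_proj A u h) + (A u h)\<^sup>2 / A u u"
    unfolding conj_proj_def self_adjoint_diff_expand[OF assms(2)]
    using assms(3) by (simp add: field_simps power2_eq_square)
  also have "G h h - (1 / G u u) * (G u h)\<^sup>2 + (1 / A u u) * (A u h)\<^sup>2
     = G (conj_proj G u h) (conj_proj G u h) + (A u h)\<^sup>2 / A u u"
    unfolding conj_proj_def self_adjoint_diff_expand[OF assms(2)]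
    using assms(4) by (simp add: field_simps power2_eq_square)
  finally show ?thesis by (simp add: algebra_simps diff_divide_distrib)
qed

text \<open>
  Each projected \<open>G\<close>-term is the value of \<open>G\<close> at a point of the line through \<open>h\<close>. It is at least
  the value of \<open>A\<close> there, hence at least the minimum of \<open>A\<close> on the line; and it is at most the value
  of \<open>G\<close> at the \<open>A\<close>-projection, because the \<open>G\<close>-projection minimises \<open>G\<close>. The condition
  \<open>1 \<le> \<eta>\<close> absorbs the rank-one term into the upper bound.
\<close>

lemma Broyd_sandwich:
  assumes "self_adjoint A" "pos_def A" "self_adjoint G" "0 \<le> \<phi>" "\<phi> \<le> 1" "1 \<le> \<eta>"
    and "A \<preceq>\<^sub>L G" "G \<preceq>\<^sub>L \<eta> *\<^sub>R A"
  shows "A \<preceq>\<^sub>L Broyd \<phi> A G u" "Broyd \<phi> A G u \<preceq>\<^sub>L \<eta> *\<^sub>R A"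
proof -
  have "A h h \<le> Broyd \<phi> A G u h h \<and> Broyd \<phi> A G u h h \<le> \<eta> * A h h" for h
  proof (cases "u = 0")
    case True
    thus ?thesis using assms(7,8) by (simp add: Broyd_def loewner_le_iff blinfun.scaleR_left)
  next
    case False
    have Au: "A u u > 0" and Gu: "G u u > 0"
      using assms(2) pos_def_mono[OF assms(2,7)] False by (auto simp: pos_def_def)
    define m where "m = A (conj_proj A u h) (conj_proj A u h)"
    define gA where "gA = G (conj_proj A u h) (conj_proj A u h)"
    define gG where "gG = G (conj_proj G u h) (conj_proj G u h)"
    define r where "r = (A u h)\<^sup>2 / A u u"
    have AG: "A k k \<le> G k k" "G k k \<le> \<eta> * A k k" for k
      using assms(7,8) by (auto simp: loewner_le_iff blinfun.scaleR_left)
    have m_gA: "m \<le> gA" and gA_m: "gA \<le> \<eta> * m"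
      unfolding m_def gA_def by (rule AG)+
    have m_gG: "m \<le> gG"
      unfolding m_def gG_def conj_proj_def[of G]
      using conj_proj_minimal[OF assms(1) Au] AG(1) by (rule order_trans)
    have gG_gA: "gG \<le> gA"
      unfolding gA_def gG_def conj_proj_def[of A]
      by (rule conj_proj_minimal[OF assms(3) Gu])
    have Ah: "A h h = m + r"
      unfolding m_def r_def using assms(1) Au by (intro conj_proj_Pythagoras) auto
    have Broyd_h: "Broyd \<phi> A G u h h = \<phi> * gA + (1 - \<phi>) * gG + r"
      unfolding gA_def gG_def r_def by (rule Broyd_quadratic_form[OF assms(1,3) Au Gu])
    have "m \<le> \<phi> * gA + (1 - \<phi>) * gG"
      using convex_bound_le[of "- gA" "- m" "- gG" \<phi> "1 - \<phi>"] m_gA m_gG assms(4,5) by simp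
    moreover have "\<phi> * gA + (1 - \<phi>) * gG \<le> gA"
      using convex_bound_le[of gA gA gG \<phi> "1 - \<phi>"] gG_gA assms(4,5) by simp
    moreover have "r \<le> \<eta> * r"
      using mult_right_mono[OF assms(6), of r] Au by (simp add: r_def)
    ultimately show ?thesis
      unfolding Broyd_h Ah using gA_m by (simp add: distrib_left)
  qed
  thus "A \<preceq>\<^sub>L Broyd \<phi> A G u" "Broyd \<phi> A G u \<preceq>\<^sub>L \<eta> *\<^sub>R A"
    by (simp_all add: loewner_le_iff blinfun.scaleR_left)
qed

section \<open>Contraction of a quasi-Newton step\<close>

text \<open>
  Inversion reverses the order: $G^{-1} \preceq A^{-1} \preceq \eta G^{-1}$, evaluated at the
  functional $A w = G y$. Both bounds come from expanding a nonnegative square,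
  $\langle A(w - y), w - y\rangle$ and $\langle G(y - w/\eta), y - w/\eta\rangle$.
\<close>

lemma inverse_sandwich:
  assumes "self_adjoint G" "self_adjoint A" "pos_def A" "0 < \<eta>"
    and "A \<preceq>\<^sub>L G" "G \<preceq>\<^sub>L \<eta> *\<^sub>R A" "G y = A w"
  shows "G y y \<le> A w w" "A w w \<le> \<eta> * G y y"
proof -
  have "0 \<le> A (w - 1 *\<^sub>R y) (w - 1 *\<^sub>R y)"
    by (rule pos_def_nonneg[OF assms(3)])
  also have "\<dots> = A w w - 2 * A w y + A y y"
    unfolding self_adjoint_diff_expand[OF assms(2)] by (simp add: self_adjointD[OF assms(2), of y w])
  also have "\<dots> = A w w - 2 * G y y + A y y"
    by (simp add: assms(7))
  finally show "G y y \<le> A w w"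
    using assms(5) unfolding loewner_le_iff by (smt (verit))
next
  have "0 \<le> G (y - (1 / \<eta>) *\<^sub>R w) (y - (1 / \<eta>) *\<^sub>R w)"
    by (rule pos_def_nonneg[OF pos_def_mono[OF assms(3,5)]])
  also have "\<dots> = G y y - 2 / \<eta> * A w w + (1 / \<eta>)\<^sup>2 * G w w"
    unfolding self_adjoint_diff_expand[OF assms(1)]
    by (simp add: self_adjointD[OF assms(1), of w y] assms(7))
  also have "\<dots> \<le> G y y - 2 / \<eta> * A w w + (1 / \<eta>)\<^sup>2 * (\<eta> * A w w)"
    using assms(6) by (auto simp: loewner_le_iff blinfun.scaleR_left intro!: mult_left_mono)
  also have "\<dots> = G y y - A w w / \<eta>"
    using assms(4) by (simp add: field_simps power2_eq_square)
  finally show "A w w \<le> \<eta> * G y y"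
    using assms(4) by (simp add: field_simps)
qed

text \<open>
  Put $S = I - G^{-1} A$, so that $S v = v - z$, and let
  $\sigma(p) = \langle A S p, p\rangle = \langle A p, p\rangle - \langle G q, q\rangle$ where
  $G q = A p$. Inversion of the sandwich says $0 \<le> \sigma(p) \<le> c \langle A p, p\rangle$ with
  $c = 1 - 1/\eta$. The claim $\langle A S v, S v\rangle \<le> c^2 \langle A v, v\rangle$ follows by
  expanding $\sigma(c v - S v) \<ge> 0$, a Cauchy--Schwarz argument with the optimal multiplier
  inserted.
\<close>

lemma quasi_Newton_contraction:
  assumes "self_adjoint A" "pos_def A" "self_adjoint G" "1 \<le> \<eta>"
    and "A \<preceq>\<^sub>L G" "G \<preceq>\<^sub>L \<eta> *\<^sub>R A" "G z = A v"
  shows "A (v - z) (v - z) \<le> (1 - 1 / \<eta>)\<^sup>2 * A v v"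
proof -
  define c where "c = 1 - 1 / \<eta>"
  define w where "w = v - z"
  define y where "y = inv_op G (A w)"
  have c: "0 \<le> c" and \<eta>: "0 < \<eta>" using assms(4) by (auto simp: c_def)
  have Gy: "G y = A w"
    unfolding y_def by (rule inv_op_right[OF pos_def_mono[OF assms(2,5)]])
  note inverse = inverse_sandwich[OF assms(3,1,2) \<eta> assms(5,6)]
  have upper: "A p p - G q q \<le> c * A p p" if "G q = A p" for p q
    using inverse(2)[OF that] \<eta> by (simp add: c_def field_simps)
  have Aw: "A w w = A w v - G y z"
    by (simp add: Gy w_def blinfun.diff_right)
  have expand: "0 \<le> t\<^sup>2 * (A v v - G z z) - 2 * t * A w w + (A w w - G y y)" for t
  proof -
    have "G (t *\<^sub>R z - 1 *\<^sub>R y) = A (t *\<^sub>R v - 1 *\<^sub>R w)"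
      by (simp add: blinfun.diff_right blinfun.scaleR_right Gy assms(7))
    from inverse(1)[OF this]
    have "G (t *\<^sub>R z - 1 *\<^sub>R y) (t *\<^sub>R z - 1 *\<^sub>R y) \<le> A (t *\<^sub>R v - 1 *\<^sub>R w) (t *\<^sub>R v - 1 *\<^sub>R w)" .
    thus ?thesis
      unfolding self_adjoint_diff_expand[OF assms(1)] self_adjoint_diff_expand[OF assms(3)]
      by (simp add: blinfun.scaleR_left blinfun.scaleR_right power2_eq_square Aw algebra_simps)
  qed
  have "A w w \<le> c\<^sup>2 * A v v"
  proof (cases "c = 0")
    case True
    \<comment> \<open>Here \<open>\<sigma>\<close> vanishes, and multiplier \<open>c\<close> gives no information; multiplier \<open>1\<close> does.\<close>
    from expand[of 1] upper[OF assms(7)] upper[OF Gy] True show ?thesis by simp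
  next
    case False
    have "c\<^sup>2 * (A v v - G z z) \<le> c\<^sup>2 * (c * A v v)"
      by (intro mult_left_mono upper assms(7)) simp
    with expand[of c] upper[OF Gy] have "0 \<le> c * (c\<^sup>2 * A v v - A w w)"
      by (simp add: algebra_simps)
    with c False show ?thesis by (simp add: zero_le_mult_iff)
  qed
  thus ?thesis by (simp add: c_def w_def)
qed

section \<open>Linear convergence on a quadratic\<close>

theorem theorem3p1:
  fixes A B :: "'a::euclidean_space dual_op"
    and b :: "'a dual"
    and f :: "'a \<Rightarrow> real"
    and \<mu> L :: real
    and \<phi> :: "nat \<Rightarrow> real"
    and x u :: "nat \<Rightarrow> 'a"
    and G :: "nat \<Rightarrow> 'a dual_op"
  assumes "self_adjoint A" and "pos_def A"
    and "f = quadratic_fun A b"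
    and "self_adjoint B" and "pos_def B"
    and "\<mu> > 0" and "L > 0"
    and "\<mu> *\<^sub>R B \<preceq>\<^sub>L A" and "A \<preceq>\<^sub>L L *\<^sub>R B"
    and "\<And>k. 0 \<le> \<phi> k \<and> \<phi> k \<le> 1"
    and "G 0 = L *\<^sub>R B"
    and "\<And>k. x (Suc k) = x k - inv_op (G k) (gradient f (x k))"
    and "\<And>k. u k = x (Suc k) - x k"
    and "\<And>k. G (Suc k) = Broyd (\<phi> k) A (G k) (u k)"
  shows "\<forall>k. (A \<preceq>\<^sub>L G k \<and> G k \<preceq>\<^sub>L (L / \<mu>) *\<^sub>R A)
           \<and> local_grad_norm f A (x k) \<le> (1 - \<mu> / L) ^ k * local_grad_norm f A (x 0)"
proof -
  \<comment> \<open>The space is nontrivial, so the two bounds on \<open>A\<close> force \<open>\<mu> \<le> L\<close>.\<close>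
  obtain e :: 'a where e: "e \<in> Basis" using nonempty_Basis by blast
  have "\<mu> * B e e \<le> L * B e e"
    using assms(8,9) by (auto simp: loewner_le_iff blinfun.scaleR_left intro: order_trans)
  moreover have "B e e > 0" using assms(5) e nonzero_Basis by (auto simp: pos_def_def)
  ultimately have "\<mu> \<le> L" by simp
  hence \<eta>: "1 \<le> L / \<mu>" and rate: "0 \<le> 1 - \<mu> / L" using assms(6,7) by auto
  have G: "self_adjoint (G k) \<and> A \<preceq>\<^sub>L G k \<and> G k \<preceq>\<^sub>L (L / \<mu>) *\<^sub>R A" for k
  proof (induction k)
    case 0
    have "L * B h h \<le> L / \<mu> * A h h" for h
    proof -
      have "\<mu> * B h h \<le> A h h" using assms(8) by (simp add: loewner_le_iff blinfun.scaleR_left)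
      from mult_left_mono[OF this, of "L / \<mu>"] show ?thesis using assms(6,7) by simp
    qed
    thus ?case
      using assms(4,9) by (simp add: assms(11) self_adjoint_def loewner_le_iff blinfun.scaleR_left)
  next
    case (Suc k)
    thus ?case
      unfolding assms(14) using assms(1,2,10) \<eta>
      by (auto intro: Broyd_self_adjoint Broyd_sandwich)
  qed
  \<comment> \<open>The gradient in primal coordinates; its \<open>A\<close>-norm is the local gradient norm.\<close>
  define v where "v k = inv_op A (gradient f (x k))" for k
  have Av: "A (v k) = gradient f (x k)" for k
    unfolding v_def by (rule inv_op_right[OF assms(2)])
  have norm_v: "local_grad_norm f A (x k) = sqrt (A (v k) (v k))" for k
    unfolding local_grad_norm_def Av by (simp only: v_def)
  have step: "local_grad_norm f A (x (Suc k)) \<le> (1 - \<mu> / L) * local_grad_norm f A (x k)" for k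
  proof -
    define z where "z = inv_op (G k) (gradient f (x k))"
    have Gz: "G k z = A (v k)"
      unfolding z_def Av by (rule inv_op_right) (use pos_def_mono assms(2) G in blast)
    have "gradient f (x (Suc k)) = gradient f (x k) - A z"
      unfolding assms(12) assms(3) gradient_quadratic_fun[OF assms(1)]
      by (simp add: z_def assms(3) gradient_quadratic_fun[OF assms(1)] blinfun.diff_right)
    hence "gradient f (x (Suc k)) = A (v k - z)"
      by (simp add: Av blinfun.diff_right)
    hence "v (Suc k) = v k - z"
      by (simp add: v_def inv_op_left[OF assms(2)])
    hence "A (v (Suc k)) (v (Suc k)) \<le> (1 - \<mu> / L)\<^sup>2 * A (v k) (v k)"
      using quasi_Newton_contraction[OF assms(1,2) _ \<eta> _ _ Gz] G[of k] by simp
    hence "sqrt (A (v (Suc k)) (v (Suc k))) \<le> sqrt ((1 - \<mu> / L)\<^sup>2 * A (v k) (v k))"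
      by simp
    thus ?thesis using rate by (simp add: norm_v real_sqrt_mult)
  qed
  have "local_grad_norm f A (x k) \<le> (1 - \<mu> / L) ^ k * local_grad_norm f A (x 0)" for k
  proof (induction k)
    case (Suc k)
    from order_trans[OF step mult_left_mono[OF Suc rate]] show ?case
      by (simp add: mult.assoc)
  qed simp
  thus ?thesis using G by blast
qed

end
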